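(* Let $\mathcal{A}\in\mathbb{R}^{n_1\times\cdots\times n_d}$ be an order-$d$ real tensor, $N=n_1+\cdots+n_d$, and let $x\in\mathbb{R}^N$ have unit 2-norm and be partitioned as $x=\begin{bmatrix}u_1\\ \vdots\\ u_d\end{bmatrix}$ with $u_k\in\mathbb{R}^{n_k}$. Then $$\nabla_x\phi_{\mathcal{A}}^{(sym)}(x)=\begin{bmatrix}\mathcal{A}_{(1)}\tilde u_1\\ \vdots\\ \mathcal{A}_{(d)}\tilde u_d\end{bmatrix}-d\begin{bmatrix}(u_1^T\mathcal{A}_{(1)}\tilde u_1)\,u_1\\ \vdots\\ (u_d^T\mathcal{A}_{(d)}\tilde u_d)\,u_d\end{bmatrix}.$$
   Context: An order-$d$ tensor $\mathcal{A}\in\mathbb{R}^{n_1\times\cdots\times n_d}$ is a real $d$-dimensional array with entries $\mathcal{A}(\mathbf{i})=\mathcal{A}(i_1,\ldots,i_d)$, $1\le i_k\le n_k$. Transposition: for a permutation $\mathbf{p}=[p_1,\ldots,p_d]$ of $1,\ldots,d$, $\mathcal{A}^{<\mathbf{p}>}\in\mathbb{R}^{n_{p_1}\times\cdots\times n_{p_d}}$ is defined by $\mathcal{A}^{<\mathbf{p}>}(j_{p_1},\ldots,j_{p_d})=\mathcal{A}(j_1,\ldots,j_d)$ for $1\le j_k\le n_k$. Symmetric embedding: let $N=n_1+\cdots+n_d$ and partition the index range $1,\ldots,N$ into consecutive ranges $\mathbf{r}_1,\ldots,\mathbf{r}_d$ with $\mathbf{r}_k = (1+n_1+\cdots+n_{k-1}),\ldots,(n_1+\cdots+n_k)$.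 Then $\mathcal{C}=\mathbf{sym}(\mathcal{A})$ is the order-$d$ tensor in $\mathbb{R}^{N\times\cdots\times N}$ whose blocks $\mathcal{C}_{\mathbf{i}}=\mathcal{C}(\mathbf{r}_{i_1},\ldots,\mathbf{r}_{i_d})$, $1\le i_k\le d$, are $\mathcal{C}_{\mathbf{i}}=\mathcal{A}^{<\mathbf{i}>}$ if $\mathbf{i}=[i_1,\ldots,i_d]$ is a permutation of $1,\ldots,d$, and $\mathcal{C}_{\mathbf{i}}=0$ otherwise. Symmetric Rayleigh quotient: with $\mathcal{C}=\mathbf{sym}(\mathcal{A})$, for nonzero $x\in\mathbb{R}^N$, $$\phi_{\mathcal{A}}^{(sym)}(x)=\frac{1}{d!}\left(\sum_{i_1=1}^N\cdots\sum_{i_d=1}^N\mathcal{C}(i_1,\ldots,i_d)x(i_1)\cdots x(i_d)\right)\Big/\|x\|_2^{d}.$$ Modal unfolding: for index vectors $\mathbf{i},\mathbf{s}$ of length $e$, $ivec(\mathbf{i},\mathbf{s})=i_1+(i_2-1)s_1+\cdots+(i_e-1)(s_1\cdots s_{e-1})$. The mode-$k$ unfolding $\mathcal{A}_{(k)}$ is the matrix with $n_k$ rows and $\prod_{j\ne k}n_j$ columns given by $\mathcal{A}_{(k)}(i_k,ivec(\tilde{\mathbf{i}},\tilde{\mathbf{n}}))=\mathcal{A}(\mathbf{i})$, where $\tilde{\mathbf{i}},\tilde{\mathbf{n}}$ are $\mathbf{i}=[i_1,\ldots,i_d]$, $\mathbf{n}=[n_1,\ldots,n_d]$ with the $k$-th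 entry deleted. For vectors $u_k\in\mathbb{R}^{n_k}$, $\tilde u_k = u_d\otimes\cdots\otimes u_{k+1}\otimes u_{k-1}\otimes\cdots\otimes u_1$ (Kronecker product). *)

theory Defs
  imports
    "HOL-Analysis.Derivative"
    "HOL-Analysis.L2_Norm"
    "HOL-Combinatorics.Multiset_Permutations"
    "Jordan_Normal_Form.Matrix"
begin

text \<open>
  All indices are counted from 0: modes are \<open>0..<d\<close>, index \<open>i\<^sub>k\<close> ranges over \<open>0..<n\<^sub>k\<close>.
  A tensor with dimension list \<open>ns = [n\<^sub>0,\<dots>,n\<^sub>(d-1)]\<close> is a function on
  multi-indices; its values outside \<open>multi_indices ns\<close> never matter.
\<close>

type_synonym tensor = "nat list \<Rightarrow> real"

definition multi_indices :: "nat list \<Rightarrow> nat list set" where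
  "multi_indices ns = {i. length i = length ns \<and> (\<forall>k<length ns. i ! k < ns ! k)}"

subsection \<open>Vectors\<close>

definition norm2_vec :: "real vec \<Rightarrow> real" where
  "norm2_vec x = L2_set (\<lambda>i. vec_index x i) {..<dim_vec x}"

text \<open>
  The gradient of a function of vectors whose dimension is a natural number: Frechet
  differentiability at \<open>x\<close> with derivative \<open>h \<mapsto> g \<bullet> h\<close>.
  The lemma below identifies it with the library's \<open>GDERIV\<close> in every Euclidean space
  of dimension \<open>dim_vec x\<close>.
\<close>

definition has_gradient_vec :: "(real vec \<Rightarrow> real) \<Rightarrow> real vec \<Rightarrow> real vec \<Rightarrow> bool" where
  "has_gradient_vec f x g \<longleftrightarrow> dim_vec g = dim_vec x \<and>
     (\<forall>\<epsilon>>0. \<exists>\<delta>>0. \<forall>y\<in>carrier_vec (dim_vec x).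
        norm2_vec (y - x) < \<delta> \<longrightarrow>
        \<bar>f y - f x - scalar_prod g (y - x)\<bar> \<le> \<epsilon> * norm2_vec (y - x))"

lemma has_gradient_vec_iff_gderiv:
  fixes e :: "nat \<Rightarrow> 'a::euclidean_space" and a b :: 'a
  assumes e: "bij_betw e {..<n} Basis"
  defines "to_vec \<equiv> \<lambda>v. vec n (\<lambda>i. inner v (e i))"
  shows "has_gradient_vec f (to_vec a) (to_vec b) \<longleftrightarrow> (GDERIV (\<lambda>v. f (to_vec v)) a :> b)"
proof -
  have sums: "sum (\<lambda>i. h (e i)) {..<n} = sum h Basis" for h :: "'a \<Rightarrow> real"
    using sum.reindex_bij_betw[OF e] .
  have diff: "to_vec v - to_vec w = to_vec (v - w)" for v w
    by (rule eq_vecI) (auto simp: to_vec_def inner_diff_left)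
  have nrm: "norm2_vec (to_vec v) = norm v" for v
    using sums[of "\<lambda>c. (inner v c)\<^sup>2"]
    by (simp add: norm2_vec_def to_vec_def L2_set_def norm_eq_sqrt_inner
        euclidean_inner[of v v] power2_eq_square)
  have sp: "scalar_prod (to_vec v) (to_vec w) = inner v w" for v w
    using sums[of "\<lambda>c. inner v c * inner w c"]
    by (simp add: scalar_prod_def to_vec_def euclidean_inner[of v w] lessThan_atLeast0)
  have surj: "\<exists>v. y = to_vec v" if y: "y \<in> carrier_vec n" for y
  proof
    let ?v = "\<Sum>c\<in>Basis. vec_index y (inv_into {..<n} e c) *\<^sub>R c"
    have "inner ?v (e i) = vec_index y i" if "i < n" for i
    proof -
      have "e i \<in> Basis" "inv_into {..<n} e (e i) = i"
        using e that by (auto simp: bij_betw_def)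
      thus ?thesis by (simp add: inner_sum_left_Basis)
    qed
    with y show "y = to_vec ?v" by (intro eq_vecI) (auto simp: to_vec_def)
  qed
  have car: "to_vec v \<in> carrier_vec n" "dim_vec (to_vec v) = n" for v
    by (simp_all add: to_vec_def)
  have all: "(\<forall>y\<in>carrier_vec n. P y) \<longleftrightarrow> (\<forall>v. P (to_vec v))" for P
    using surj car by blast
  show ?thesis
    unfolding has_gradient_vec_def gderiv_def has_derivative_at_alt car all diff nrm sp
    by (simp add: bounded_linear_inner_left inner_commute)
qed

definition concat_vecs :: "'a vec list \<Rightarrow> 'a vec" where
  "concat_vecs vs = foldr append_vec vs vNil"

definition kron_vec :: "'a::times vec \<Rightarrow> 'a vec \<Rightarrow> 'a vec" where
  "kron_vec v w = vec (dim_vec v * dim_vec w)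
     (\<lambda>i. vec_index v (i div dim_vec w) * vec_index w (i mod dim_vec w))"

definition delete_nth :: "nat \<Rightarrow> 'a list \<Rightarrow> 'a list" where
  "delete_nth k xs = take k xs @ drop (Suc k) xs"

text \<open>
  \<open>u\<^sub>(d-1) \<otimes> \<dots> \<otimes> u\<^sub>(k+1) \<otimes> u\<^sub>(k-1) \<otimes> \<dots> \<otimes> u\<^sub>0\<close>; the empty product,
  which occurs for \<open>d = 1\<close>, is the vector \<open>[1]\<close>.
\<close>

definition kron_without :: "nat \<Rightarrow> real vec list \<Rightarrow> real vec" where
  "kron_without k us = foldr kron_vec (rev (delete_nth k us)) (vec 1 (\<lambda>_. 1))"

subsection \<open>Modal unfolding\<close>

text \<open>With indices counted from 0, the offsets \<open>-1\<close> in the usual formula for \<open>ivec\<close> disappear.\<close>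

definition ivec :: "nat list \<Rightarrow> nat list \<Rightarrow> nat" where
  "ivec i s = (\<Sum>m<length i. i ! m * prod_list (take m s))"

definition unfolding_mat :: "nat list \<Rightarrow> tensor \<Rightarrow> nat \<Rightarrow> real mat" where
  "unfolding_mat ns A k = mat (ns ! k) (prod_list (delete_nth k ns))
     (\<lambda>(r, c). A (THE i. i \<in> multi_indices ns \<and> i ! k = r \<and>
                        ivec (delete_nth k i) (delete_nth k ns) = c))"

subsection \<open>Transposition and symmetric embedding\<close>

definition tensor_transpose :: "nat list \<Rightarrow> tensor \<Rightarrow> tensor" where
  "tensor_transpose p A i = A (THE j. length j = length p \<and> map (\<lambda>k. j ! k) p = i)"

lemma tensor_transpose_entry:
  assumes p: "p \<in> permutations_of_set {..<d}" and j: "length j = d"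
  shows "tensor_transpose p A (map (\<lambda>k. j ! k) p) = A j"
proof -
  have sp: "set p = {..<d}" "length p = d"
    using p by (auto simp: permutations_of_set_def distinct_card[symmetric])
  have "(THE j'. length j' = length p \<and> map (\<lambda>k. j' ! k) p = map (\<lambda>k. j ! k) p) = j"
    by (rule the_equality) (use sp j in \<open>auto intro!: nth_equalityI\<close>)
  thus ?thesis by (simp add: tensor_transpose_def)
qed

definition block_start :: "nat list \<Rightarrow> nat \<Rightarrow> nat" where
  "block_start ns k = sum_list (take k ns)"

text \<open>The \<open>k\<close> with \<open>j\<close> in the range \<open>\<r>\<^sub>k\<close>.\<close>

definition block_of :: "nat list \<Rightarrow> nat \<Rightarrow> nat" where
  "block_of ns j = (THE k. k < length ns \<and> block_start ns k \<le> j \<and> j < block_start ns (Suc k))"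

definition sym_embed :: "nat list \<Rightarrow> tensor \<Rightarrow> tensor" where
  "sym_embed ns A I =
     (let b = map (block_of ns) I in
      if b \<in> permutations_of_set {..<length ns}
      then tensor_transpose b A (map (\<lambda>j. j - block_start ns (block_of ns j)) I)
      else 0)"

lemma block_start_Suc: "k < length ns \<Longrightarrow> block_start ns (Suc k) = block_start ns k + ns ! k"
  by (simp add: block_start_def take_Suc_conv_app_nth)

lemma block_start_mono: "k \<le> l \<Longrightarrow> block_start ns k \<le> block_start ns l"
proof (induction rule: dec_induct)
  case (step l)
  have "block_start ns l \<le> block_start ns (Suc l)"
    by (cases "l < length ns") (simp add: block_start_Suc, simp add: block_start_def)
  with step show ?case by simp
qed simp

lemma block_of_eq:
  assumes "k < length ns" "j < ns ! k"
  shows "block_of ns (block_start ns k + j) = k"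
  unfolding block_of_def
proof (rule the_equality)
  show "k < length ns \<and> block_start ns k \<le> block_start ns k + j \<and>
        block_start ns k + j < block_start ns (Suc k)"
    using assms by (simp add: block_start_Suc)
next
  fix l
  assume l: "l < length ns \<and> block_start ns l \<le> block_start ns k + j \<and>
             block_start ns k + j < block_start ns (Suc l)"
  show "l = k"
  proof (rule ccontr)
    assume "l \<noteq> k"
    then consider "Suc l \<le> k" | "Suc k \<le> l" by linarith
    thus False
    proof cases
      case 1
      thus ?thesis using block_start_mono[of "Suc l" k ns] l by linarith
    next
      case 2
      thus ?thesis using block_start_mono[of "Suc k" l ns] l assms
        by (simp add: block_start_Suc)
    qed
  qed
qed

lemma sym_embed_block:
  assumes "length b = length ns" "set b \<subseteq> {..<length ns}"
    and j: "j \<in> multi_indices (map ((!) ns) b)"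
  shows "sym_embed ns A (map2 (\<lambda>k i. block_start ns k + i) b j) =
    (if b \<in> permutations_of_set {..<length ns} then tensor_transpose b A j else 0)"
proof -
  let ?I = "map2 (\<lambda>k i. block_start ns k + i) b j"
  have lj: "length j = length b" "\<And>k. k < length b \<Longrightarrow> j ! k < ns ! (b ! k)"
    using j by (auto simp: multi_indices_def)
  have bl: "block_of ns (?I ! k) = b ! k" if "k < length b" for k
  proof -
    have "b ! k < length ns" using assms(2) that nth_mem by blast
    thus ?thesis using that lj by (simp add: block_of_eq)
  qed
  have 1: "map (block_of ns) ?I = b"
    by (rule nth_equalityI) (use lj bl in \<open>simp_all\<close>)
  have 2: "map (\<lambda>j. j - block_start ns (block_of ns j)) ?I = j"
    by (rule nth_equalityI) (use lj bl in \<open>simp_all\<close>)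
  show ?thesis unfolding sym_embed_def 1 2 Let_def ..
qed

lemma ivec_Cons: "ivec (a # i) (m # s) = a + m * ivec i s"
  by (simp add: ivec_def sum.lessThan_Suc_shift sum_distrib_left mult_ac del: sum.lessThan_Suc)

lemma multi_indices_Cons:
  "a # i \<in> multi_indices (m # s) \<longleftrightarrow> a < m \<and> i \<in> multi_indices s"
  by (auto simp: multi_indices_def less_Suc_eq_0_disj)

lemma ivec_less: "i \<in> multi_indices s \<Longrightarrow> ivec i s < prod_list s"
proof (induction s arbitrary: i)
  case Nil
  thus ?case by (simp add: ivec_def multi_indices_def)
next
  case (Cons m s)
  obtain a i' where i: "i = a # i'"
    using Cons.prems by (cases i) (auto simp: multi_indices_def)
  have "a < m" and less: "ivec i' s < prod_list s"
    using Cons i by (auto simp: multi_indices_Cons)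
  have "a + m * ivec i' s < m * Suc (ivec i' s)" using \<open>a < m\<close> by simp
  also have "\<dots> \<le> m * prod_list s" using less by (intro mult_le_mono) auto
  finally show ?case by (simp add: i ivec_Cons)
qed

lemma ivec_inj: "inj_on (\<lambda>i. ivec i s) (multi_indices s)"
proof (induction s)
  case Nil
  thus ?case by (auto simp: inj_on_def multi_indices_def)
next
  case (Cons m s)
  show ?case
  proof (rule inj_onI)
    fix i j
    assume A: "i \<in> multi_indices (m # s)" "j \<in> multi_indices (m # s)"
      "ivec i (m # s) = ivec j (m # s)"
    obtain a i' where i: "i = a # i'" using A by (cases i) (auto simp: multi_indices_def)
    obtain b j' where j: "j = b # j'" using A by (cases j) (auto simp: multi_indices_def)
    have ab: "a < m" "b < m" "i' \<in> multi_indices s" "j' \<in> multi_indices s"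
      using A by (auto simp: i j multi_indices_Cons)
    have eq: "a + m * ivec i' s = b + m * ivec j' s" using A by (simp add: i j ivec_Cons)
    have "a = b" using arg_cong[OF eq, of "\<lambda>x. x mod m"] ab by simp
    moreover have "ivec i' s = ivec j' s" using eq \<open>a = b\<close> ab by simp
    hence "i' = j'" using Cons ab by (auto dest: inj_onD)
    ultimately show "i = j" by (simp add: i j)
  qed
qed

lemma delete_nth_multi_indices:
  assumes i: "i \<in> multi_indices ns"
  shows "delete_nth k i \<in> multi_indices (delete_nth k ns)"
  using i by (auto simp: delete_nth_def multi_indices_def nth_append min_def)

lemma unfolding_mat_entry:
  assumes i: "i \<in> multi_indices ns" and k: "k < length ns"
  shows "i ! k < dim_row (unfolding_mat ns A k)"
    and "ivec (delete_nth k i) (delete_nth k ns) < dim_col (unfolding_mat ns A k)"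
    and "unfolding_mat ns A k $$ (i ! k, ivec (delete_nth k i) (delete_nth k ns)) = A i"
proof -
  show r: "i ! k < dim_row (unfolding_mat ns A k)"
    using i k by (simp add: unfolding_mat_def multi_indices_def)
  show c: "ivec (delete_nth k i) (delete_nth k ns) < dim_col (unfolding_mat ns A k)"
    using ivec_less[OF delete_nth_multi_indices[OF i]] by (simp add: unfolding_mat_def)
  have "(THE i'. i' \<in> multi_indices ns \<and> i' ! k = i ! k \<and>
          ivec (delete_nth k i') (delete_nth k ns) = ivec (delete_nth k i) (delete_nth k ns)) = i"
  proof (rule the_equality)
    fix j
    assume j: "j \<in> multi_indices ns \<and> j ! k = i ! k \<and>
      ivec (delete_nth k j) (delete_nth k ns) = ivec (delete_nth k i) (delete_nth k ns)"
    hence del: "delete_nth k j = delete_nth k i"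
      using ivec_inj[of "delete_nth k ns"] delete_nth_multi_indices i by (auto dest!: inj_onD)
    have len: "length j = length ns" "length i = length ns"
      using i j by (auto simp: multi_indices_def)
    have "take k j = take k i \<and> drop (Suc k) j = drop (Suc k) i"
      using del len by (simp add: delete_nth_def)
    thus "j = i"
      using j k len id_take_nth_drop[of k j] id_take_nth_drop[of k i] by simp
  qed (use i in simp)
  thus "unfolding_mat ns A k $$ (i ! k, ivec (delete_nth k i) (delete_nth k ns)) = A i"
    using r c by (simp add: unfolding_mat_def)
qed

subsection \<open>Symmetric Rayleigh quotient\<close>

definition sym_rayleigh :: "nat list \<Rightarrow> tensor \<Rightarrow> real vec \<Rightarrow> real" where
  "sym_rayleigh ns A x =
     (let d = length ns; N = sum_list ns in
      1 / fact d *
      (\<Sum>I\<in>multi_indices (replicate d N). sym_embed ns A I * (\<Prod>k<d. vec_index x (I ! k)))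
      / norm2_vec x ^ d)"

end

theory Submission
  imports Defs "HOL-Analysis.Bounded_Continuous_Function"
begin

text \<open>
  The nonzero entries of the symmetric embedding are indexed by pairs of a permutation \<open>p\<close> of the
  modes and a multi-index \<open>i\<close> of \<open>A\<close>, and every \<open>p\<close> contributes the same summand. The Rayleigh
  quotient is therefore \<open>S(y) / \<parallel>y\<parallel>\<^sup>d\<close> with \<open>S(y) = \<Sum>\<^sub>i A(i) \<Prod>\<^sub>k y\<^sub>k(i\<^sub>k)\<close> multilinear in the blocks
  \<open>y\<^sub>k\<close> of \<open>y\<close>. The partial gradient of \<open>S\<close> in the \<open>k\<close>-th block at \<open>x\<close> is the \<open>k\<close>-th unfolding
  applied to the Kronecker product of the other blocks, whose inner product with \<open>u\<^sub>k\<close> is \<open>S(x)\<close>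
  again; on the unit sphere the quotient rule then subtracts \<open>d S(x) x\<close>.
\<close>

section \<open>Multi-indices\<close>

lemma multi_indices_Nil: "multi_indices [] = {[]}"
  by (auto simp: multi_indices_def)

lemma multi_indices_Cons_image:
  "multi_indices (m # s) = (\<lambda>(a, i). a # i) ` ({..<m} \<times> multi_indices s)"
proof (intro equalityI subsetI)
  fix j assume j: "j \<in> multi_indices (m # s)"
  then obtain a i where "j = a # i" by (cases j) (auto simp: multi_indices_def)
  with j show "j \<in> (\<lambda>(a, i). a # i) ` ({..<m} \<times> multi_indices s)"
    by (auto simp: multi_indices_Cons)
qed (auto simp: multi_indices_Cons)

lemma finite_multi_indices [simp]: "finite (multi_indices s)"
  by (induction s) (simp_all add: multi_indices_Nil multi_indices_Cons_image)

lemma card_multi_indices: "card (multi_indices s) = prod_list s"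
proof (induction s)
  case (Cons m s)
  have "inj_on (\<lambda>(a, i). a # i) ({..<m} \<times> multi_indices s)" by (auto simp: inj_on_def)
  thus ?case by (simp add: multi_indices_Cons_image card_image card_cartesian_product Cons)
qed (simp add: multi_indices_Nil)

lemma prod_list_delete_nth:
  fixes xs :: "'a::comm_monoid_mult list"
  assumes k: "k < length xs"
  shows "prod_list xs = xs ! k * prod_list (delete_nth k xs)"
  using arg_cong[OF id_take_nth_drop[OF k], of prod_list]
  by (simp add: delete_nth_def mult_ac)

text \<open>Overwriting entry \<open>k\<close> by 1 changes neither the list with that entry deleted
  nor its product. This replaces a division by \<open>xs ! k\<close>, which a monoid does not
  offer.\<close>

lemma prod_list_delete_nth_conv_prod:
  fixes xs :: "'a::comm_monoid_mult list"
  assumes k: "k < length xs"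
  shows "prod_list (delete_nth k xs) = (\<Prod>l\<in>{..<length xs} - {k}. xs ! l)"
proof -
  let ?f = "\<lambda>l. if l = k then 1 else xs ! l"
  have d: "delete_nth k (xs[k := 1]) = delete_nth k xs"
    using k by (simp add: delete_nth_def)
  have "prod_list (delete_nth k xs) = prod_list (xs[k := 1])"
    using prod_list_delete_nth[of k "xs[k := 1]"] k d by simp
  also have "\<dots> = (\<Prod>l<length xs. ?f l)"
    using k by (auto simp: prod.list_conv_set_nth nth_list_update lessThan_atLeast0 intro!: prod.cong)
  also have "\<dots> = (\<Prod>l\<in>{..<length xs} - {k}. ?f l)"
    using k by (intro prod.mono_neutral_right) auto
  also have "\<dots> = (\<Prod>l\<in>{..<length xs} - {k}. xs ! l)" by (rule prod.cong) auto
  finally show ?thesis .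
qed

lemma map2_delete_nth:
  "map2 f (delete_nth k xs) (delete_nth k ys) = delete_nth k (map2 f xs ys)"
  if "length xs = length ys"
  using that by (simp add: delete_nth_def take_map drop_map take_zip drop_zip zip_append)

text \<open>Injectivity is the well-definedness of the unfolding; surjectivity follows by counting.\<close>

lemma bij_betw_unfolding_index:
  assumes k: "k < length ns"
  shows "bij_betw (\<lambda>i. (i ! k, ivec (delete_nth k i) (delete_nth k ns))) (multi_indices ns)
           ({..<ns ! k} \<times> {..<prod_list (delete_nth k ns)})"
    (is "bij_betw ?f _ ?T")
proof -
  have inj: "inj_on ?f (multi_indices ns)"
  proof (rule inj_onI)
    fix i j assume i: "i \<in> multi_indices ns" and j: "j \<in> multi_indices ns" and "?f i = ?f j"
    hence e: "i ! k = j ! k"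
      "ivec (delete_nth k i) (delete_nth k ns) = ivec (delete_nth k j) (delete_nth k ns)" by auto
    \<comment> \<open>For every tensor, the same matrix entry equals both \<open>A i\<close> and
      \<open>A j\<close>. The indicator function of \<open>i\<close> then separates the two
      indices.\<close>
    have "A i = A j" for A :: tensor
      using unfolding_mat_entry(3)[OF i k, of A] unfolding_mat_entry(3)[OF j k, of A] e by simp
    from this[of "\<lambda>l. if l = i then 1 else 0"] show "i = j" by (auto split: if_splits)
  qed
  have sub: "?f ` multi_indices ns \<subseteq> ?T"
    using k ivec_less[OF delete_nth_multi_indices] by (auto simp: multi_indices_def)
  have "card (?f ` multi_indices ns) = card ?T"
    using prod_list_delete_nth[OF k]
    by (simp add: card_image[OF inj] card_multi_indices card_cartesian_product)
  with sub have "?f ` multi_indices ns = ?T" by (intro card_subset_eq) auto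
  with inj show ?thesis by (simp add: bij_betw_def)
qed

section \<open>Kronecker products and unfoldings\<close>

text \<open>The position is written with the index of the second factor running fastest, which is
  the shape of the recursion \<open>ivec_Cons\<close>.\<close>

lemma kron_vec_index:
  assumes "a < dim_vec v" "j < dim_vec w"
  shows "vec_index (kron_vec v w) (j + dim_vec w * a) = vec_index v a * vec_index w j"
proof -
  have "j + dim_vec w * a < dim_vec w * Suc a" using assms by simp
  also have "\<dots> \<le> dim_vec w * dim_vec v" using assms by (intro mult_le_mono) auto
  finally show ?thesis using assms by (simp add: kron_vec_def mult.commute)
qed

lemma dim_kron_vec [simp]: "dim_vec (kron_vec v w) = dim_vec v * dim_vec w"
  by (simp add: kron_vec_def)

lemma dim_foldr_kron_vec:
  "dim_vec (foldr kron_vec (rev vs) e) = dim_vec e * prod_list (map dim_vec vs)"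
  by (induction vs arbitrary: e) (simp_all add: mult_ac)

text \<open>Because of \<open>rev\<close>, the head \<open>v\<close> is multiplied first, onto the
  start vector, so that \<open>e\<close> becomes \<open>kron_vec v e\<close> in the recursive call.
  Hence \<open>e\<close> and the position \<open>j\<close> in it must be general in the induction;
  the new position \<open>j + dim_vec e * a\<close> selects entry \<open>a\<close> of
  \<open>v\<close> and entry \<open>j\<close> of \<open>e\<close>.\<close>

lemma foldr_kron_vec_index:
  fixes e :: "'a::comm_monoid_mult vec"
  assumes "i \<in> multi_indices (map dim_vec vs)" "j < dim_vec e"
  shows "vec_index (foldr kron_vec (rev vs) e) (j + dim_vec e * ivec i (map dim_vec vs)) =
    vec_index e j * prod_list (map2 vec_index vs i)"
  using assms
proof (induction vs arbitrary: e i j)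
  case Nil
  thus ?case by (simp add: multi_indices_Nil ivec_def)
next
  case (Cons v vs)
  obtain a i' where i: "i = a # i'"
    using Cons.prems by (cases i) (auto simp: multi_indices_def)
  have a: "a < dim_vec v" and i': "i' \<in> multi_indices (map dim_vec vs)"
    using Cons.prems by (auto simp: i multi_indices_Cons)
  let ?j = "j + dim_vec e * a"
  have "?j < dim_vec e * Suc a" using Cons.prems by simp
  also have "\<dots> \<le> dim_vec (kron_vec v e)"
    using a by (simp add: mult.commute[of "dim_vec v"] del: mult_Suc_right)
  finally have j: "?j < dim_vec (kron_vec v e)" .
  have "vec_index (foldr kron_vec (rev (v # vs)) e) (j + dim_vec e * ivec i (map dim_vec (v # vs)))
    = vec_index (foldr kron_vec (rev vs) (kron_vec v e))
        (?j + dim_vec (kron_vec v e) * ivec i' (map dim_vec vs))"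
    by (simp add: i ivec_Cons algebra_simps)
  also have "\<dots> = vec_index (kron_vec v e) ?j * prod_list (map2 vec_index vs i')"
    by (rule Cons.IH[OF i' j])
  finally show ?case
    unfolding kron_vec_index[OF a Cons.prems(2)] by (simp add: i mult_ac)
qed

text \<open>Columns of the unfolding and entries of the Kronecker product are numbered alike, with
  the lowest remaining mode running fastest. The empty product \<open>[1]\<close> is the start
  vector, read at position 0.\<close>

lemma kron_without_index:
  assumes i: "i \<in> multi_indices (map dim_vec us)" and k: "k < length us"
  shows "vec_index (kron_without k us) (ivec (delete_nth k i) (delete_nth k (map dim_vec us))) =
    (\<Prod>l\<in>{..<length us} - {k}. vec_index (us ! l) (i ! l))"
proof -
  have dm: "delete_nth k (map dim_vec us) = map dim_vec (delete_nth k us)"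
    by (simp add: delete_nth_def take_map drop_map)
  have len: "length us = length i" using i by (simp add: multi_indices_def)
  have "vec_index (kron_without k us) (ivec (delete_nth k i) (delete_nth k (map dim_vec us)))
      = prod_list (map2 vec_index (delete_nth k us) (delete_nth k i))"
    using foldr_kron_vec_index[OF delete_nth_multi_indices[OF i, of k, unfolded dm],
        where e = "vec 1 (\<lambda>_. 1)" and j = 0]
    by (simp add: kron_without_def dm)
  also have "\<dots> = (\<Prod>l\<in>{..<length us} - {k}. map2 vec_index us i ! l)"
    using k len by (simp add: map2_delete_nth prod_list_delete_nth_conv_prod)
  also have "\<dots> = (\<Prod>l\<in>{..<length us} - {k}. vec_index (us ! l) (i ! l))"
    using len by (intro prod.cong) auto
  finally show ?thesis .
qed

text \<open>Pairs of a row and a column are exchanged for multi-indices. The weight \<open>h\<close>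
  is left free for two uses: a block of a direction gives a partial differential of the multilinear
  form, and \<open>us ! k\<close> itself gives the value of the form.\<close>

lemma sum_unfolding_kron_without:
  assumes ns: "ns = map dim_vec us" and k: "k < length ns"
  shows "(\<Sum>r<ns ! k. vec_index (unfolding_mat ns A k *\<^sub>v kron_without k us) r * h r) =
    (\<Sum>i\<in>multi_indices ns. A i * (h (i ! k) * (\<Prod>l\<in>{..<length ns} - {k}. vec_index (us ! l) (i ! l))))"
proof -
  let ?M = "unfolding_mat ns A k" and ?w = "kron_without k us" and ?P = "prod_list (delete_nth k ns)"
  have "delete_nth k ns = map dim_vec (delete_nth k us)"
    by (simp add: ns delete_nth_def take_map drop_map)
  hence dw: "dim_vec ?w = ?P" by (simp add: kron_without_def dim_foldr_kron_vec)
  have dM: "dim_row ?M = ns ! k" "dim_col ?M = ?P" by (simp_all add: unfolding_mat_def)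
  have "(\<Sum>r<ns ! k. vec_index (?M *\<^sub>v ?w) r * h r) =
      (\<Sum>r<ns ! k. \<Sum>c<?P. ?M $$ (r, c) * vec_index ?w c * h r)"
    by (intro sum.cong refl)
       (simp add: scalar_prod_def dM dw sum_distrib_right lessThan_atLeast0)
  also have "\<dots> = (\<Sum>(r, c)\<in>{..<ns ! k} \<times> {..<?P}. ?M $$ (r, c) * vec_index ?w c * h r)"
    by (rule sum.cartesian_product)
  also have "\<dots> = (\<Sum>i\<in>multi_indices ns. A i * (h (i ! k) *
      (\<Prod>l\<in>{..<length ns} - {k}. vec_index (us ! l) (i ! l))))"
    unfolding sum.reindex_bij_betw[OF bij_betw_unfolding_index[OF k], symmetric]
    using k by (intro sum.cong refl)
      (simp add: unfolding_mat_entry(3) kron_without_index ns)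
  finally show ?thesis .
qed

section \<open>Block vectors\<close>

lemma concat_vecs_Nil [simp]: "concat_vecs [] = vNil"
  and concat_vecs_Cons [simp]: "concat_vecs (v # vs) = append_vec v (concat_vecs vs)"
  by (simp_all add: concat_vecs_def)

lemma dim_concat_vecs [simp]: "dim_vec (concat_vecs vs) = sum_list (map dim_vec vs)"
  by (induction vs) auto

lemma concat_vecs_index:
  assumes "k < length vs" "r < dim_vec (vs ! k)"
  shows "vec_index (concat_vecs vs) (block_start (map dim_vec vs) k + r) = vec_index (vs ! k) r"
  using assms
proof (induction vs arbitrary: k)
  case (Cons v vs)
  show ?case
  proof (cases k)
    case 0
    with Cons.prems show ?thesis by (simp add: block_start_def)
  next
    case (Suc l)
    let ?s = "block_start (map dim_vec vs) l"
    have "?s + r < block_start (map dim_vec vs) (Suc l)"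
      using Cons.prems Suc by (simp add: block_start_Suc)
    also have "\<dots> \<le> block_start (map dim_vec vs) (length vs)"
      using Cons.prems Suc by (intro block_start_mono) auto
    finally have "?s + r < dim_vec (concat_vecs vs)" by (simp add: block_start_def)
    thus ?thesis using Cons Suc by (simp add: block_start_def)
  qed
qed simp

lemma sum_lessThan_add:
  fixes f :: "nat \<Rightarrow> 'a::comm_monoid_add"
  shows "sum f {..<a + b} = sum f {..<a} + (\<Sum>r<b. f (a + r))"
  by (induction b) (simp_all add: ac_simps)

lemma sum_blocks:
  fixes f :: "nat \<Rightarrow> 'a::comm_monoid_add"
  shows "(\<Sum>k<length ns. \<Sum>r<ns ! k. f (block_start ns k + r)) = sum f {..<sum_list ns}"
proof -
  \<comment> \<open>Generalised to the first \<open>m\<close> blocks, which together fill the range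
    below \<open>block_start ns m\<close>.\<close>
  have "(\<Sum>k<m. \<Sum>r<ns ! k. f (block_start ns k + r)) = sum f {..<block_start ns m}"
    if "m \<le> length ns" for m
    using that
    by (induction m) (simp add: block_start_def, simp add: block_start_Suc sum_lessThan_add)
  from this[of "length ns"] show ?thesis by (simp add: block_start_def)
qed

lemma block_start_add_less:
  assumes "k < length ns" "r < ns ! k"
  shows "block_start ns k + r < sum_list ns"
proof -
  have "block_start ns k + r < block_start ns (Suc k)" using assms by (simp add: block_start_Suc)
  also have "\<dots> \<le> block_start ns (length ns)" using assms by (intro block_start_mono) simp
  finally show ?thesis by (simp add: block_start_def)
qed

lemma block_decomposition:
  assumes "j < sum_list ns"
  obtains k r where "k < length ns" "r < ns ! k" "j = block_start ns k + r"
proof -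
  have "\<exists>k r. k < length ns \<and> r < ns ! k \<and> j = block_start ns k + r"
    if "m \<le> length ns" "j < block_start ns m" for m
    using that
  proof (induction m)
    case (Suc m)
    show ?case
    proof (cases "j < block_start ns m")
      case False
      with Suc.prems have "m < length ns" "j - block_start ns m < ns ! m"
        "j = block_start ns m + (j - block_start ns m)"
        by (auto simp: block_start_Suc)
      thus ?thesis by blast
    qed (use Suc in auto)
  qed (simp add: block_start_def)
  from this[of "length ns"] assms that show ?thesis by (auto simp: block_start_def)
qed

lemma concat_vecs_scalar_prod:
  assumes "map dim_vec vs = ns" "dim_vec z = sum_list ns"
  shows "scalar_prod (concat_vecs vs) z =
    (\<Sum>k<length ns. \<Sum>r<ns ! k. vec_index (vs ! k) r * vec_index z (block_start ns k + r))"
proof -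
  have "scalar_prod (concat_vecs vs) z =
      (\<Sum>j<sum_list ns. vec_index (concat_vecs vs) j * vec_index z j)"
    using assms by (simp add: scalar_prod_def lessThan_atLeast0)
  also have "\<dots> = (\<Sum>k<length ns. \<Sum>r<ns ! k. vec_index (concat_vecs vs) (block_start ns k + r) *
      vec_index z (block_start ns k + r))"
    by (rule sum_blocks[symmetric])
  also have "\<dots> = (\<Sum>k<length ns. \<Sum>r<ns ! k. vec_index (vs ! k) r * vec_index z (block_start ns k + r))"
    using assms(1) by (intro sum.cong refl) (auto simp: concat_vecs_index)
  finally show ?thesis .
qed

section \<open>The multilinear form of a symmetric embedding\<close>

text \<open>The factor \<open>fact (length ns)\<close> counts the permutations and cancels the
  normalisation of the Rayleigh quotient.\<close>

lemma sym_embed_form: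
  fixes y :: "nat \<Rightarrow> real"
  shows "(\<Sum>I\<in>multi_indices (replicate (length ns) (sum_list ns)).
            sym_embed ns A I * (\<Prod>k<length ns. y (I ! k))) =
    fact (length ns) * (\<Sum>i\<in>multi_indices ns. A i * (\<Prod>k<length ns. y (block_start ns k + i ! k)))"
proof -
  define d where "d = length ns"
  define P where "P = permutations_of_set {..<d}"
  define M where "M = multi_indices (replicate d (sum_list ns))"
  define S where "S = {I \<in> M. map (block_of ns) I \<in> P}"
  \<comment> \<open>Position \<open>m\<close> of the image lies in block \<open>p ! m\<close>, at
    the offset that \<open>i\<close> prescribes for that mode.\<close>
  define \<phi> where "\<phi> = (\<lambda>(p, i). map (\<lambda>k. block_start ns k + i ! k) p)"
  define g where "g = (\<lambda>I. sym_embed ns A I * (\<Prod>k<d. y (I ! k)))"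
  define f where "f = (\<lambda>i. A i * (\<Prod>k<d. y (block_start ns k + i ! k)))"
  have P: "set p = {..<d}" "distinct p" "length p = d" if "p \<in> P" for p
    using that by (auto simp: P_def permutations_of_set_def distinct_card[symmetric])
  have I: "length i = d" "\<And>k. k < d \<Longrightarrow> i ! k < ns ! k" if "i \<in> multi_indices ns" for i
    using that by (auto simp: multi_indices_def d_def)
  have block: "block_of ns (block_start ns k + i ! k) = k"
    if "p \<in> P" "i \<in> multi_indices ns" "k \<in> set p" for p i k
    using that P[of p] I[of i] by (intro block_of_eq) (auto simp: d_def)
  \<comment> \<open>Block numbers recover \<open>p\<close>, and offsets recover \<open>i\<close>
    reordered by \<open>p\<close>. This gives injectivity and also evaluates
    \<open>sym_embed\<close> on the image.\<close>
  have blk: "map (block_of ns) (\<phi> (p, i)) = p"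
    and off: "map (\<lambda>j. j - block_start ns (block_of ns j)) (\<phi> (p, i)) = map (\<lambda>k. i ! k) p"
    if "p \<in> P" "i \<in> multi_indices ns" for p i
    using block[OF that] by (simp_all add: \<phi>_def map_idI)
  have "bij_betw \<phi> (P \<times> multi_indices ns) S"
    unfolding bij_betw_def
  proof
    show "inj_on \<phi> (P \<times> multi_indices ns)"
    proof (rule inj_onI, clarify)
      fix p i q j
      assume A: "p \<in> P" "i \<in> multi_indices ns" "q \<in> P" "j \<in> multi_indices ns"
        and eq: "\<phi> (p, i) = \<phi> (q, j)"
      have pq: "p = q" using blk[OF A(1,2)] blk[OF A(3,4)] eq by simp
      have "map (\<lambda>k. i ! k) p = map (\<lambda>k. j ! k) p"
        using off[OF A(1,2)] off[OF A(3,4)] eq pq by simp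
      hence "i = j" using P[OF A(1)] I[OF A(2)] I[OF A(4)] by (auto intro!: nth_equalityI)
      with pq show "p = q \<and> i = j" by simp
    qed
    show "\<phi> ` (P \<times> multi_indices ns) = S"
    proof (intro equalityI subsetI)
      fix J assume "J \<in> \<phi> ` (P \<times> multi_indices ns)"
      then obtain p i where J: "J = \<phi> (p, i)" and A: "p \<in> P" "i \<in> multi_indices ns" by auto
      have "\<phi> (p, i) ! m < sum_list ns" if m: "m < d" for m
      proof -
        have "p ! m < d" using P[OF A(1)] m nth_mem[of m p] by auto
        thus ?thesis using P[OF A(1)] I[OF A(2)] m
          by (simp add: \<phi>_def block_start_add_less d_def)
      qed
      thus "J \<in> S" using blk[OF A] P[OF A(1)] A
        by (auto simp: J S_def M_def multi_indices_def \<phi>_def)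
    next
      fix J assume J: "J \<in> S"
      define p where "p = map (block_of ns) J"
      have p: "p \<in> P" using J by (simp add: S_def p_def)
      have lJ: "length J = d" and Jlt: "\<And>m. m < d \<Longrightarrow> J ! m < sum_list ns"
        using J by (auto simp: S_def M_def multi_indices_def)
      have ent: "p ! m < d \<and> block_start ns (p ! m) \<le> J ! m \<and>
          J ! m - block_start ns (p ! m) < ns ! (p ! m)" if m: "m < d" for m
      proof -
        obtain k r where "k < length ns" "r < ns ! k" "J ! m = block_start ns k + r"
          using block_decomposition[OF Jlt[OF m]] .
        thus ?thesis using m lJ block_of_eq by (simp add: p_def d_def)
      qed
      have "\<forall>k<d. \<exists>m<d. p ! m = k"
      proof (intro allI impI)
        fix k assume "k < d"
        hence "k \<in> set p" using P(1)[OF p] by simp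
        thus "\<exists>m<d. p ! m = k" using P(3)[OF p] by (auto simp: in_set_conv_nth)
      qed
      \<comment> \<open>The choice \<open>q\<close> is a right inverse of \<open>p\<close>;
        distinctness of \<open>p\<close> makes it a left inverse as well, in
        \<open>qp\<close>.\<close>
      then obtain q where q: "\<And>k. k < d \<Longrightarrow> q k < d \<and> p ! q k = k" by metis
      have qp: "q (p ! m) = m" if m: "m < d" for m
      proof -
        have "p ! q (p ! m) = p ! m" "q (p ! m) < d" using q ent m by blast+
        thus ?thesis using P[OF p] m by (simp add: nth_eq_iff_index_eq)
      qed
      \<comment> \<open>The preimage: mode \<open>k\<close> occurs in \<open>J\<close> at position
        \<open>q k\<close>, and its offset there is the index for mode \<open>k\<close>.\<close>
      define i where "i = map (\<lambda>k. J ! q k - block_start ns k) [0..<d]"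
      have ik: "i ! k < ns ! k" if k: "k < d" for k
        using ent[of "q k"] q[OF k] k by (simp add: i_def)
      have "i \<in> multi_indices ns" using ik by (simp add: multi_indices_def d_def i_def)
      moreover have "J = \<phi> (p, i)"
      proof (rule nth_equalityI)
        show "length J = length (\<phi> (p, i))" using lJ P[OF p] by (simp add: \<phi>_def)
        fix m assume "m < length J"
        hence m: "m < d" using lJ by simp
        show "J ! m = \<phi> (p, i) ! m"
          using ent[OF m] qp[OF m] P[OF p] m by (simp add: \<phi>_def i_def)
      qed
      ultimately show "J \<in> \<phi> ` (P \<times> multi_indices ns)" using p by blast
    qed
  qed
  note bij = this
  \<comment> \<open>The transposed entry of \<open>A\<close> at the reordered index is
    \<open>A i\<close> again, and the product over positions is a product over all modes because
    \<open>p\<close> lists each mode once. So the summand is independent of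
    \<open>p\<close>.\<close>
  have val: "g (\<phi> (p, i)) = f i" if A: "p \<in> P" "i \<in> multi_indices ns" for p i
  proof -
    have "sym_embed ns A (\<phi> (p, i)) = A i"
      unfolding sym_embed_def Let_def blk[OF A] off[OF A]
      using A tensor_transpose_entry[of p d i A] I[OF A(2)] by (simp add: P_def d_def)
    moreover have "(\<Prod>k<d. y (\<phi> (p, i) ! k)) = prod_list (map y (\<phi> (p, i)))"
      using P[OF A(1)] by (simp add: prod.list_conv_set_nth \<phi>_def lessThan_atLeast0)
    moreover have "prod_list (map y (\<phi> (p, i))) = (\<Prod>k\<in>set p. y (block_start ns k + i ! k))"
      unfolding prod.distinct_set_conv_list[OF P(2)[OF A(1)]] by (simp add: \<phi>_def o_def)
    ultimately show ?thesis using P[OF A(1)] by (simp add: g_def f_def)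
  qed
  have "sum g M = sum g S"
  proof (rule sum.mono_neutral_right)
    show "finite M" "S \<subseteq> M" by (auto simp: M_def S_def)
    show "\<forall>I\<in>M - S. g I = 0"
      by (auto simp: S_def g_def sym_embed_def P_def d_def Let_def)
  qed
  also have "\<dots> = (\<Sum>z\<in>P \<times> multi_indices ns. g (\<phi> z))"
    by (rule sum.reindex_bij_betw[OF bij, symmetric])
  also have "\<dots> = (\<Sum>(p, i)\<in>P \<times> multi_indices ns. f i)"
    using val by (intro sum.cong) auto
  also have "\<dots> = (\<Sum>p\<in>P. sum f (multi_indices ns))"
    by (rule sum.cartesian_product[symmetric])
  also have "\<dots> = fact d * sum f (multi_indices ns)"
    by (simp add: P_def)
  finally show ?thesis by (simp add: g_def f_def M_def d_def)
qed

section \<open>Differentiation\<close>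

lemma norm2_vec_index_le: "i < dim_vec v \<Longrightarrow> \<bar>vec_index v i\<bar> \<le> norm2_vec v"
  using member_le_L2_set[of "{..<dim_vec v}" i "\<lambda>i. \<bar>vec_index v i\<bar>"]
  by (simp add: norm2_vec_def L2_set_def)

text \<open>Every function on the discrete space of naturals is continuous, so this type is the
  space of bounded sequences with the supremum norm. Vectors enter it by padding with zeros.\<close>

definition bcontfun_of_vec :: "real vec \<Rightarrow> (nat \<Rightarrow>\<^sub>C real)" where
  "bcontfun_of_vec v = Bcontfun (\<lambda>i. if i < dim_vec v then vec_index v i else 0)"

lemma apply_bcontfun_of_vec:
  "apply_bcontfun (bcontfun_of_vec v) i = (if i < dim_vec v then vec_index v i else 0)"
proof -
  have "(\<lambda>i. if i < dim_vec v then vec_index v i else 0) \<in> bcontfun"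
  proof (rule bcontfun_normI)
    show "norm (if i < dim_vec v then vec_index v i else 0) \<le> norm2_vec v" for i
      using norm2_vec_index_le[of i v] by (auto simp: norm2_vec_def)
  qed (rule continuous_on_discrete)
  thus ?thesis by (simp add: bcontfun_of_vec_def Bcontfun_inverse)
qed

lemma bcontfun_of_vec_diff:
  assumes "dim_vec v = dim_vec w"
  shows "bcontfun_of_vec (v - w) = bcontfun_of_vec v - bcontfun_of_vec w"
  using assms by (intro bcontfun_eqI) (auto simp: apply_bcontfun_of_vec)

text \<open>Each entry is bounded by the 2-norm. Through this inequality both the closeness
  condition and the error bound of a derivative pass from the supremum norm to the 2-norm.\<close>

lemma norm_bcontfun_of_vec_le: "norm (bcontfun_of_vec v) \<le> norm2_vec v"
  using norm2_vec_index_le[of _ v]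
  by (intro norm_bound) (auto simp: apply_bcontfun_of_vec norm2_vec_def)

lemma bounded_linear_apply_bcontfun_at: "bounded_linear (\<lambda>v :: nat \<Rightarrow>\<^sub>C real. apply_bcontfun v j)"
proof (rule bounded_linear_intro[where K = 1])
  show "norm (apply_bcontfun v j) \<le> norm v * 1" for v :: "nat \<Rightarrow>\<^sub>C real"
    using norm_bounded[of v j] by simp
qed simp_all

text \<open>Vectors of every dimension embed into one normed space with norm at most \<open>norm2_vec\<close>,
  so the library's derivatives become available although the dimension is not a type.\<close>

lemma has_gradient_vec_if_has_derivative:
  assumes "(F has_derivative F') (at (bcontfun_of_vec x))"
    and "dim_vec g = dim_vec x"
    and f: "\<And>y. dim_vec y = dim_vec x \<Longrightarrow> f y = F (bcontfun_of_vec y)"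
    and g: "\<And>h. dim_vec h = dim_vec x \<Longrightarrow> F' (bcontfun_of_vec h) = scalar_prod g h"
  shows "has_gradient_vec f x g"
  unfolding has_gradient_vec_def
proof (intro conjI allI impI)
  fix \<epsilon> :: real assume \<epsilon>: "\<epsilon> > 0"
  then obtain \<delta> where \<delta>: "\<delta> > 0" "\<And>z. norm (z - bcontfun_of_vec x) < \<delta> \<Longrightarrow>
      norm (F z - F (bcontfun_of_vec x) - F' (z - bcontfun_of_vec x)) \<le> \<epsilon> * norm (z - bcontfun_of_vec x)"
    using assms(1) unfolding has_derivative_at_alt by blast
  show "\<exists>\<delta>>0. \<forall>y\<in>carrier_vec (dim_vec x). norm2_vec (y - x) < \<delta> \<longrightarrow>
      \<bar>f y - f x - scalar_prod g (y - x)\<bar> \<le> \<epsilon> * norm2_vec (y - x)"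
  proof (intro exI[of _ \<delta>] conjI ballI impI)
    fix y assume y: "y \<in> carrier_vec (dim_vec x)" and lt: "norm2_vec (y - x) < \<delta>"
    have dy: "dim_vec y = dim_vec x" using y by simp
    have le: "norm (bcontfun_of_vec y - bcontfun_of_vec x) \<le> norm2_vec (y - x)"
      using norm_bcontfun_of_vec_le[of "y - x"] dy by (simp add: bcontfun_of_vec_diff)
    have "\<bar>f y - f x - scalar_prod g (y - x)\<bar> \<le> \<epsilon> * norm (bcontfun_of_vec y - bcontfun_of_vec x)"
      using \<delta>(2)[of "bcontfun_of_vec y"] le lt f[OF dy] f[of x] g[of "y - x"] dy
      by (simp add: bcontfun_of_vec_diff)
    also have "\<dots> \<le> \<epsilon> * norm2_vec (y - x)" using le \<epsilon> by simp
    finally show "\<bar>f y - f x - scalar_prod g (y - x)\<bar> \<le> \<epsilon> * norm2_vec (y - x)" .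
  qed (use \<delta> in simp)
qed (use assms in simp)

text \<open>The quotient rule where all denominators are 1: the square root has slope 1/2 there, and
  the power contributes \<open>d\<close>. The 2-norm appears as the root of a polynomial
  \<open>Q\<close> because it is not the norm of the sequence space.\<close>

lemma has_derivative_divide_sqrt_power:
  fixes S Q :: "'a::real_normed_vector \<Rightarrow> real"
  assumes S: "(S has_derivative S') (at a)" and Q: "(Q has_derivative Q') (at a)" and a: "Q a = 1"
  shows "((\<lambda>v. S v / sqrt (Q v) ^ d) has_derivative (\<lambda>h. S' h - real d / 2 * S a * Q' h)) (at a)"
proof -
  have "(sqrt has_real_derivative 1 / 2) (at (Q a))"
    using DERIV_real_sqrt[of "Q a"] a by (simp add: field_simps)
  hence "((\<lambda>v. sqrt (Q v)) has_derivative (\<lambda>h. 1 / 2 * Q' h)) (at a)"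
    unfolding has_field_derivative_def by (rule has_derivative_compose[OF Q])
  from has_derivative_divide[OF S has_derivative_power[OF this, of d]] show ?thesis
    using a by (simp add: algebra_simps)
qed

theorem theorem4p5:
  fixes ns :: "nat list" and A :: tensor and x :: "real vec" and us :: "real vec list"
  assumes "x \<in> carrier_vec (sum_list ns)" and "norm2_vec x = 1"
    and "length us = length ns" and "\<forall>k<length ns. us ! k \<in> carrier_vec (ns ! k)"
    and "x = concat_vecs us"
  shows "has_gradient_vec (sym_rayleigh ns A) x
    (concat_vecs (map (\<lambda>k. unfolding_mat ns A k *\<^sub>v kron_without k us) [0..<length ns])
     - real (length ns) \<cdot>\<^sub>v
       concat_vecs (map (\<lambda>k. scalar_prod (us ! k) (unfolding_mat ns A k *\<^sub>v kron_without k us)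
                             \<cdot>\<^sub>v (us ! k)) [0..<length ns]))"
proof -
  define d where "d = length ns"
  define N where "N = sum_list ns"
  define s where "s = block_start ns"
  \<comment> \<open>\<open>S\<close> and \<open>Q\<close> extend the multilinear form and the
    squared 2-norm to all bounded sequences; both read only the first \<open>N\<close>
    entries.\<close>
  define S where "S = (\<lambda>v :: nat \<Rightarrow>\<^sub>C real.
    \<Sum>i\<in>multi_indices ns. A i * (\<Prod>k<d. apply_bcontfun v (s k + i ! k)))"
  define Q where "Q = (\<lambda>v :: nat \<Rightarrow>\<^sub>C real. \<Sum>j<N. (apply_bcontfun v j)\<^sup>2)"
  define X where "X = bcontfun_of_vec x"
  \<comment> \<open>Product rule: in each monomial the factor of one mode \<open>k\<close> is
    replaced by the entry of the direction.\<close>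
  define S' where "S' = (\<lambda>h :: nat \<Rightarrow>\<^sub>C real. \<Sum>i\<in>multi_indices ns. A i *
    (\<Sum>k<d. apply_bcontfun h (s k + i ! k) * (\<Prod>l\<in>{..<d} - {k}. apply_bcontfun X (s l + i ! l))))"
  define Q' where "Q' = (\<lambda>h :: nat \<Rightarrow>\<^sub>C real. \<Sum>j<N. 2 * apply_bcontfun h j * apply_bcontfun X j)"
  define w where "w = (\<lambda>k. unfolding_mat ns A k *\<^sub>v kron_without k us)"
  define G where "G = concat_vecs (map w [0..<d])"
  define H where "H = concat_vecs (map (\<lambda>k. scalar_prod (us ! k) (w k) \<cdot>\<^sub>v (us ! k)) [0..<d])"

  have lus: "length us = d" using assms(3) by (simp add: d_def)
  have ns: "ns = map dim_vec us"
    using assms(3,4) by (intro nth_equalityI) auto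
  have dimus: "dim_vec (us ! k) = ns ! k" if "k < d" for k
    using assms(4) that by (simp add: d_def)
  have dx: "dim_vec x = N" using assms(1) by (simp add: N_def)
  have dw: "dim_vec (w k) = ns ! k" for k by (simp add: w_def unfolding_mat_def)
  have dimw: "map dim_vec (map w [0..<d]) = ns"
    by (intro nth_equalityI) (simp_all add: dw d_def)
  have dimu: "map dim_vec (map (\<lambda>k. c k \<cdot>\<^sub>v (us ! k)) [0..<d]) = ns" for c
    by (intro nth_equalityI) (simp_all add: ns d_def)
  have dG: "dim_vec G = N" unfolding G_def N_def dim_concat_vecs dimw ..
  have dH: "dim_vec H = N" unfolding H_def N_def dim_concat_vecs dimu ..
  have ap: "apply_bcontfun (bcontfun_of_vec y) j = vec_index y j" if "j < N" "dim_vec y = N" for y :: "real vec" and j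
    using that by (simp add: apply_bcontfun_of_vec)
  have less: "s k + i ! k < N" if "k < d" "i \<in> multi_indices ns" for k i
    using that by (auto simp: s_def N_def d_def multi_indices_def intro!: block_start_add_less)
  have xu: "vec_index x (s k + r) = vec_index (us ! k) r" if "k < d" "r < ns ! k" for k r
    using that concat_vecs_index[of k us r, folded ns] by (simp add: s_def lus dimus assms(5))
  have Xu: "apply_bcontfun X (s l + i ! l) = vec_index (us ! l) (i ! l)"
    if "l < d" "i \<in> multi_indices ns" for l i
    using that less[OF that] dx by (simp add: X_def ap xu multi_indices_def d_def)
  \<comment> \<open>The unfolding identity with the blocks of \<open>us\<close> read off from
    \<open>X\<close>, so that its right-hand side matches the summands of \<open>S'\<close>.\<close>
  have form: "(\<Sum>r<ns ! k. vec_index (w k) r * h r) =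
      (\<Sum>i\<in>multi_indices ns. A i * (h (i ! k) * (\<Prod>l\<in>{..<d} - {k}. apply_bcontfun X (s l + i ! l))))"
    if k: "k < d" for k h
  proof -
    have "(\<Prod>l\<in>{..<d} - {k}. vec_index (us ! l) (i ! l)) =
        (\<Prod>l\<in>{..<d} - {k}. apply_bcontfun X (s l + i ! l))" if "i \<in> multi_indices ns" for i
      using that Xu by (intro prod.cong) auto
    thus ?thesis
      using sum_unfolding_kron_without[OF ns, of k A h] k by (simp add: w_def d_def)
  qed

  have QX: "Q (bcontfun_of_vec y) = (norm2_vec y)\<^sup>2" if "dim_vec y = N" for y :: "real vec"
    using that by (simp add: Q_def ap norm2_vec_def L2_set_def sum_nonneg)
  \<comment> \<open>The unit norm of \<open>x\<close> enters here.\<close>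
  have Q1: "Q X = 1" using QX[OF dx] assms(2) by (simp add: X_def)
  have apd: "((\<lambda>v :: nat \<Rightarrow>\<^sub>C real. apply_bcontfun v j) has_derivative (\<lambda>h. apply_bcontfun h j)) (at X)" for j
    by (rule bounded_linear_imp_has_derivative[OF bounded_linear_apply_bcontfun_at])
  have dS: "(S has_derivative S') (at X)"
    unfolding S_def S'_def
    by (intro has_derivative_sum has_derivative_mult_right has_derivative_prod apd)
  have dQ: "(Q has_derivative Q') (at X)"
    unfolding Q_def Q'_def using has_derivative_power[OF apd, where n = 2]
    by (intro has_derivative_sum) (simp add: mult_ac)
  note deriv = has_derivative_divide_sqrt_power[OF dS dQ Q1, of d]

  \<comment> \<open>Taking \<open>us ! k\<close> as the weight restores the factor missing for mode
    \<open>k\<close>. The value is therefore the same for all \<open>k\<close>, and \<open>H\<close>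
    is the multiple \<open>S X\<close> of \<open>x\<close>.\<close>
  have uw: "scalar_prod (us ! k) (w k) = S X" if k: "k < d" for k
  proof -
    have "scalar_prod (us ! k) (w k) = (\<Sum>r<ns ! k. vec_index (w k) r * apply_bcontfun X (s k + r))"
      unfolding scalar_prod_def dw lessThan_atLeast0
    proof (intro sum.cong refl)
      fix r assume r: "r \<in> {0..<ns ! k}"
      hence "s k + r < N" using k by (simp add: s_def N_def d_def block_start_add_less)
      thus "vec_index (us ! k) r * vec_index (w k) r = vec_index (w k) r * apply_bcontfun X (s k + r)"
        using r k dx by (simp add: X_def ap xu)
    qed
    also have "\<dots> = S X"
      unfolding form[OF k, of "\<lambda>r. apply_bcontfun X (s k + r)"] S_def
      using k by (intro sum.cong refl) (simp add: prod.remove[of "{..<d}" k])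
    finally show ?thesis .
  qed

  \<comment> \<open>With the \<open>k\<close>-th block of \<open>h\<close> as the weight,
    \<open>form\<close> yields the \<open>k\<close>-th summand of the product rule; exchanging the
    sums assembles \<open>S'\<close>.\<close>
  have Gh: "scalar_prod G h = S' (bcontfun_of_vec h)" if h: "dim_vec h = N" for h :: "real vec"
  proof -
    have "scalar_prod G h = (\<Sum>k<d. \<Sum>r<ns ! k. vec_index (w k) r * vec_index h (s k + r))"
      using concat_vecs_scalar_prod[OF dimw, of h] h by (simp add: G_def N_def s_def d_def)
    also have "\<dots> = (\<Sum>k<d. \<Sum>i\<in>multi_indices ns. A i * (vec_index h (s k + i ! k) *
        (\<Prod>l\<in>{..<d} - {k}. apply_bcontfun X (s l + i ! l))))"
      using form by (intro sum.cong refl) simp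
    also have "\<dots> = (\<Sum>i\<in>multi_indices ns. \<Sum>k<d. A i * (vec_index h (s k + i ! k) *
        (\<Prod>l\<in>{..<d} - {k}. apply_bcontfun X (s l + i ! l))))"
      by (rule sum.swap)
    also have "\<dots> = S' (bcontfun_of_vec h)"
      unfolding S'_def sum_distrib_left using h less by (intro sum.cong refl) (simp add: ap)
    finally show ?thesis .
  qed
  \<comment> \<open>Here the 2 from differentiating the squares in \<open>Q\<close> meets the 1/2
    from the square root.\<close>
  have Hh: "real d * scalar_prod H h = real d / 2 * S X * Q' (bcontfun_of_vec h)"
    if h: "dim_vec h = N" for h :: "real vec"
  proof -
    have "scalar_prod H h = (\<Sum>k<d. \<Sum>r<ns ! k. S X * (vec_index x (s k + r) * vec_index h (s k + r)))"
      unfolding H_def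
      using concat_vecs_scalar_prod[OF dimu, of h "\<lambda>k. scalar_prod (us ! k) (w k)"] h
      by (simp add: N_def s_def[symmetric] d_def[symmetric])
        (intro sum.cong refl, auto simp: uw xu dimus)
    also have "\<dots> = (\<Sum>j<N. S X * (vec_index x j * vec_index h j))"
      unfolding N_def d_def s_def by (rule sum_blocks)
    also have "\<dots> = S X / 2 * Q' (bcontfun_of_vec h)"
      unfolding Q'_def sum_distrib_left using h dx by (intro sum.cong refl) (simp add: ap X_def)
    finally show ?thesis by simp
  qed

  have "has_gradient_vec (sym_rayleigh ns A) x (G - real d \<cdot>\<^sub>v H)"
  proof (rule has_gradient_vec_if_has_derivative[OF deriv[unfolded X_def]])
    show "dim_vec (G - real d \<cdot>\<^sub>v H) = dim_vec x" by (simp add: dH dx)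
  next
    fix y :: "real vec" assume "dim_vec y = dim_vec x"
    hence y: "dim_vec y = N" using dx by simp
    \<comment> \<open>The two functions agree at every \<open>y\<close> of dimension
      \<open>N\<close>, even at 0, since equal numerators are divided by the same power of the
      norm.\<close>
    have "sqrt (Q (bcontfun_of_vec y)) = norm2_vec y"
      by (simp add: QX[OF y] norm2_vec_def)
    moreover have "S (bcontfun_of_vec y) =
        (\<Sum>i\<in>multi_indices ns. A i * (\<Prod>k<d. vec_index y (s k + i ! k)))"
      unfolding S_def using y less by (intro sum.cong arg_cong2[of _ _ _ _ "(*)"] prod.cong refl) (simp add: ap)
    ultimately show "sym_rayleigh ns A y = S (bcontfun_of_vec y) / sqrt (Q (bcontfun_of_vec y)) ^ d"
      by (simp add: sym_rayleigh_def Let_def sym_embed_form d_def s_def)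
  next
    fix h :: "real vec" assume "dim_vec h = dim_vec x"
    hence h: "dim_vec h = N" using dx by simp
    have "scalar_prod (G - real d \<cdot>\<^sub>v H) h = scalar_prod G h - real d * scalar_prod H h"
      using h dG dH
      by (subst minus_scalar_prod_distrib[of _ N]) (auto intro: carrier_vecI)
    thus "S' (bcontfun_of_vec h) - real d / 2 * S (bcontfun_of_vec x) * Q' (bcontfun_of_vec h) =
        scalar_prod (G - real d \<cdot>\<^sub>v H) h"
      using Gh[OF h] Hh[OF h] by (simp add: X_def)
  qed
  thus ?thesis by (simp add: G_def H_def w_def d_def)
qed

end
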